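(* For $[(X,Y,Z)]\in\mathbb{P}(\lambda,\mu,\nu)$ put $$\Phi(z)=\frac{X}{z}+\frac{Y}{z-1}+\frac{Z}{z+1},\qquad L(z)=z(z^2-1)\Phi(z)=(Y-Z)z+(Y+Z),\qquad \rho(z,\eta)=\det(L(z)-\eta I).$$ Write $$\rho(z,\eta)=\bigl(iH\,z(z^2-1)+Q_0(z)\bigr)+Q_1(z)\,\eta-\eta^3$$ with $Q_0,Q_1$ polynomials in $z$ of degree at most $2$. Then all coefficients of $Q_0$ and $Q_1$ are constant on $\mathbb{P}(\lambda,\mu,\nu)$, so that the only coefficient of the characteristic polynomial $\rho$ that can vary on $\mathbb{P}(\lambda,\mu,\nu)$ is $iH$. Moreover, up to additive constants on $\mathbb{P}(\lambda,\mu,\nu)$, the function $H$ is given by $$H=-i\det(Y-Z)=-\tfrac{i}{3}\operatorname{tr}\bigl((Y-Z)^3\bigr).$$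
   Context: $\lambda,\mu,\nu$ are real diagonal traceless $3\times3$ matrices, so $i\lambda,i\mu,i\nu\in\mathfrak{su}(3)$ (traceless anti-hermitian matrices), and $\mathcal{O}_{i\lambda},\mathcal{O}_{i\mu},\mathcal{O}_{i\nu}\subset\mathfrak{su}(3)$ are their orbits under the adjoint action of $\mathrm{SU}(3)$. The triple reduced product is $\mathbb{P}(\lambda,\mu,\nu)=\{(X,Y,Z)\in\mathcal{O}_{i\lambda}\times\mathcal{O}_{i\mu}\times\mathcal{O}_{i\nu}: X+Y+Z=0\}/\mathrm{SU}(3)$, with $\mathrm{SU}(3)$ acting diagonally by conjugation. The polynomial $\rho$ depends only on the class $[(X,Y,Z)]$. *)

theory Defs
  imports "HOL-Analysis.Analysis" "HOL-Computational_Algebra.Polynomial"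
begin

type_synonym cmat3 = "complex^3^3"

text \<open>
  The library's \<open>*\<close>, \<open>^\<close> and \<open>1\<close> on vectors act componentwise; matrix products are therefore
  always \<open>**\<close>, and \<^term>\<open>mat c\<close> is the scalar matrix \<open>c I\<close>.
\<close>

definition cscale :: "complex \<Rightarrow> cmat3 \<Rightarrow> cmat3"  (infixr "*\<^sub>M" 75)
  where "c *\<^sub>M A = map_matrix (\<lambda>a. c * a) A"

definition conj_transpose :: "cmat3 \<Rightarrow> cmat3"
  where "conj_transpose A = map_matrix cnj (transpose A)"

definition SU3 :: "cmat3 set"
  where "SU3 = {g. conj_transpose g ** g = mat 1 \<and> g ** conj_transpose g = mat 1 \<and> det g = 1}"

definition conjugate :: "cmat3 \<Rightarrow> cmat3 \<Rightarrow> cmat3"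
  where "conjugate g A = g ** A ** matrix_inv g"

definition diagonal_matrix :: "real^3^3 \<Rightarrow> bool"
  where "diagonal_matrix A \<longleftrightarrow> (\<forall>i j. i \<noteq> j \<longrightarrow> A $ i $ j = 0)"

definition i_times :: "real^3^3 \<Rightarrow> cmat3"
  where "i_times A = \<i> *\<^sub>M map_matrix complex_of_real A"

definition adjoint_orbit :: "cmat3 \<Rightarrow> cmat3 set"
  where "adjoint_orbit A = {conjugate g A | g. g \<in> SU3}"

definition zero_sum_triples ::
    "real^3^3 \<Rightarrow> real^3^3 \<Rightarrow> real^3^3 \<Rightarrow> (cmat3 \<times> cmat3 \<times> cmat3) set"
  where "zero_sum_triples lam mu nu =
    {(X, Y, Z). X \<in> adjoint_orbit (i_times lam) \<and> Y \<in> adjoint_orbit (i_times mu) \<and>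
                Z \<in> adjoint_orbit (i_times nu) \<and> X + Y + Z = 0}"

definition diagonal_conjugacy ::
    "(cmat3 \<times> cmat3 \<times> cmat3) set \<Rightarrow>
     ((cmat3 \<times> cmat3 \<times> cmat3) \<times> (cmat3 \<times> cmat3 \<times> cmat3)) set"
  where "diagonal_conjugacy T =
    {((X, Y, Z), (X', Y', Z')). (X, Y, Z) \<in> T \<and> (X', Y', Z') \<in> T \<and>
       (\<exists>g\<in>SU3. X' = conjugate g X \<and> Y' = conjugate g Y \<and> Z' = conjugate g Z)}"

definition triple_reduced_product ::
    "real^3^3 \<Rightarrow> real^3^3 \<Rightarrow> real^3^3 \<Rightarrow> (cmat3 \<times> cmat3 \<times> cmat3) set set"
  where "triple_reduced_product lam mu nu =
    zero_sum_triples lam mu nu // diagonal_conjugacy (zero_sum_triples lam mu nu)"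

definition Phi :: "cmat3 \<Rightarrow> cmat3 \<Rightarrow> cmat3 \<Rightarrow> complex \<Rightarrow> cmat3"
  where "Phi X Y Z z = (1 / z) *\<^sub>M X + (1 / (z - 1)) *\<^sub>M Y + (1 / (z + 1)) *\<^sub>M Z"

text \<open>
  Since division by zero is total in HOL, \<open>z (z\<^sup>2 - 1) \<Phi>(z)\<close> would be wrong at the poles
  \<open>0, 1, -1\<close> of \<open>\<Phi>\<close>; hence the polynomial form, whose agreement with it off the poles is
  part of the theorem.
\<close>

definition Lmat :: "cmat3 \<Rightarrow> cmat3 \<Rightarrow> cmat3 \<Rightarrow> complex \<Rightarrow> cmat3"
  where "Lmat X Y Z z = z *\<^sub>M (Y - Z) + (Y + Z)"

definition rho :: "cmat3 \<Rightarrow> cmat3 \<Rightarrow> cmat3 \<Rightarrow> complex \<Rightarrow> complex \<Rightarrow> complex"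
  where "rho X Y Z z \<eta> = det (Lmat X Y Z z - mat \<eta>)"

text \<open>
  The expansion is required for every representative of the class \<open>p\<close>, so its existence entails
  that \<open>\<rho>\<close> depends on the class only.
\<close>

definition rho_expansion ::
    "(cmat3 \<times> cmat3 \<times> cmat3) set \<Rightarrow> complex \<Rightarrow> complex poly \<Rightarrow> complex poly \<Rightarrow> bool"
  where "rho_expansion p H Q0 Q1 \<longleftrightarrow>
    degree Q0 \<le> 2 \<and> degree Q1 \<le> 2 \<and>
    (\<forall>(X, Y, Z)\<in>p. \<forall>z \<eta>.
       rho X Y Z z \<eta> = (\<i> * H * (z * (z\<^sup>2 - 1)) + poly Q0 z) + poly Q1 z * \<eta> - \<eta> ^ 3)"

end

theory Submission
  imports Defs
begin

text \<open>
  On zero-sum triples, \<open>L\<close> takes the values \<open>-X\<close>, \<open>2 Y\<close>, \<open>2 Z\<close> at the points \<open>0, 1, -1\<close>. As these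
  matrices stay in fixed orbits, the characteristic polynomials of \<open>L(0), L(1), L(-1)\<close> are fixed.
  The coefficient of \<open>\<eta>\<close> in \<open>\<rho>\<close> is quadratic in \<open>z\<close>, hence fixed by its values at these three
  points. The constant term \<open>det L(z)\<close> is cubic in \<open>z\<close> with leading coefficient \<open>det (Y - Z)\<close>, and
  subtracting \<open>det (Y - Z) z (z\<^sup>2 - 1)\<close>, which vanishes at the three points, leaves a quadratic
  polynomial that is fixed for the same reason.
\<close>

section \<open>Conjugation by SU(3) and the invariants of adjoint orbits\<close>

lemma cscale_nth [simp]: "(c *\<^sub>M A) $ i $ j = c * A $ i $ j"
  by (simp add: cscale_def map_matrix_def)

lemma
  fixes A :: "'a::semiring_1^'n^'m"
  assumes "invertible A"
  shows matrix_inv_right: "A ** matrix_inv A = mat 1"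
    and matrix_inv_left: "matrix_inv A ** A = mat 1"
  using someI_ex[OF assms[unfolded invertible_def]] by (simp_all add: matrix_inv_def)

lemma SU3_imp_invertible: "g \<in> SU3 \<Longrightarrow> invertible g"
  unfolding SU3_def invertible_def by blast

lemma mat_1_in_SU3: "mat 1 \<in> SU3"
proof -
  have "conj_transpose (mat 1) = mat 1"
    by (simp add: conj_transpose_def map_matrix_def transpose_def mat_def vec_eq_iff)
  then show ?thesis
    by (simp add: SU3_def det_I)
qed

lemma conjugate_mat_1: "conjugate (mat 1) A = A"
  using matrix_inv_right[OF SU3_imp_invertible[OF mat_1_in_SU3]] by (simp add: conjugate_def)

lemma trace_conjugate:
  assumes "invertible g"
  shows "trace (conjugate g A) = trace A"
  using trace_mul_sym[of "g ** A" "matrix_inv g"] matrix_inv_left[OF assms]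
  by (simp add: conjugate_def matrix_mul_assoc)

lemma det_conjugate:
  assumes "invertible g"
  shows "det (conjugate g A) = det A"
proof -
  have "det g * det (matrix_inv g) = 1"
    by (simp add: matrix_inv_right[OF assms] det_I flip: det_mul)
  then show ?thesis
    by (simp add: conjugate_def det_mul)
qed

lemma conjugate_mult:
  assumes "invertible g"
  shows "conjugate g (A ** B) = conjugate g A ** conjugate g B"
proof -
  have "conjugate g A ** conjugate g B = g ** A ** (matrix_inv g ** g) ** B ** matrix_inv g"
    by (simp only: conjugate_def matrix_mul_assoc)
  then show ?thesis
    by (simp add: matrix_inv_left[OF assms] conjugate_def matrix_mul_assoc)
qed

lemma conjugate_diff: "conjugate g (A - B) = conjugate g A - conjugate g B"
  by (simp add: conjugate_def matrix_matrix_mult_def vec_eq_iff sum_subtractf algebra_simps)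

text \<open>These three numbers determine the characteristic polynomial of a 3x3 matrix; the square
  reduces to the plain trace because conjugation is multiplicative.\<close>

lemma adjoint_orbit_invariants:
  assumes "A \<in> adjoint_orbit B"
  shows "det A = det B" "trace A = trace B" "trace (A ** A) = trace (B ** B)"
  using assms
  by (auto simp: adjoint_orbit_def det_conjugate trace_conjugate SU3_imp_invertible
      simp flip: conjugate_mult)

section \<open>Trace and determinant identities for 3x3 matrices\<close>

lemma trace_i_times: "trace (i_times A) = \<i> * complex_of_real (trace A)"
  by (simp add: trace_def i_times_def map_matrix_def sum_distrib_left)

text \<open>The second elementary symmetric function of the eigenvalues is
  \<open>((trace A)\<^sup>2 - trace (A ** A)) / 2\<close>, which is
  \<open>- trace (A ** A) / 2\<close> at trace zero.\<close>

lemma charpoly_traceless_3: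
  fixes A :: cmat3
  assumes "trace A = 0"
  shows "det (A - mat \<eta>) = det A + trace (A ** A) / 2 * \<eta> - \<eta> ^ 3"
proof -
  \<comment> \<open>Eliminating one diagonal entry leaves a polynomial identity in eight free
    entries.\<close>
  have A33: "A$3$3 = - A$1$1 - A$2$2"
    using assms by (simp add: trace_def sum_3 eq_neg_iff_add_eq_0 algebra_simps)
  show ?thesis
    by (simp add: A33 det_3 trace_def sum_3 matrix_matrix_mult_def mat_def algebra_simps
        power2_eq_square power3_eq_cube)
qed

text \<open>At trace zero, Cayley-Hamilton expresses the cube of \<open>A\<close> as
  \<open>det A\<close> times the identity plus a multiple of \<open>A\<close>; taking traces gives
  the formula.\<close>

lemma det_traceless_3:
  fixes A :: cmat3
  assumes "trace A = 0"
  shows "det A = trace (A ** A ** A) / 3"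
proof -
  have A33: "A$3$3 = - A$1$1 - A$2$2"
    using assms by (simp add: trace_def sum_3 eq_neg_iff_add_eq_0 algebra_simps)
  show ?thesis
    by (simp add: A33 det_3 trace_def sum_3 matrix_matrix_mult_def algebra_simps)
qed

lemma det_linear_pencil_3:
  fixes A B :: cmat3
  obtains a b where "\<And>z. det (z *\<^sub>M A + B) = det A * z ^ 3 + a * z\<^sup>2 + b * z + det B"
proof
  fix z
  \<comment> \<open>The witnesses \<open>a\<close> and \<open>b\<close> are read off from this
    equation: \<open>a\<close> collects the signed products with two factors from \<open>A\<close>
    and one from \<open>B\<close>, and \<open>b\<close> those with one from \<open>A\<close> and two
    from \<open>B\<close>.\<close>
  show "det (z *\<^sub>M A + B) = det A * z ^ 3
      + (A$1$1 * A$2$2 * B$3$3 + A$1$1 * B$2$2 * A$3$3 + B$1$1 * A$2$2 * A$3$3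
       + A$1$2 * A$2$3 * B$3$1 + A$1$2 * B$2$3 * A$3$1 + B$1$2 * A$2$3 * A$3$1
       + A$1$3 * A$2$1 * B$3$2 + A$1$3 * B$2$1 * A$3$2 + B$1$3 * A$2$1 * A$3$2
       - A$1$1 * A$2$3 * B$3$2 - A$1$1 * B$2$3 * A$3$2 - B$1$1 * A$2$3 * A$3$2
       - A$1$2 * A$2$1 * B$3$3 - A$1$2 * B$2$1 * A$3$3 - B$1$2 * A$2$1 * A$3$3
       - A$1$3 * A$2$2 * B$3$1 - A$1$3 * B$2$2 * A$3$1 - B$1$3 * A$2$2 * A$3$1) * z\<^sup>2
      + (B$1$1 * B$2$2 * A$3$3 + B$1$1 * A$2$2 * B$3$3 + A$1$1 * B$2$2 * B$3$3
       + B$1$2 * B$2$3 * A$3$1 + B$1$2 * A$2$3 * B$3$1 + A$1$2 * B$2$3 * B$3$1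
       + B$1$3 * B$2$1 * A$3$2 + B$1$3 * A$2$1 * B$3$2 + A$1$3 * B$2$1 * B$3$2
       - B$1$1 * B$2$3 * A$3$2 - B$1$1 * A$2$3 * B$3$2 - A$1$1 * B$2$3 * B$3$2
       - B$1$2 * B$2$1 * A$3$3 - B$1$2 * A$2$1 * B$3$3 - A$1$2 * B$2$1 * B$3$3
       - B$1$3 * B$2$2 * A$3$1 - B$1$3 * A$2$2 * B$3$1 - A$1$3 * B$2$2 * B$3$1) * z
      + det B"
    by (simp add: det_3 algebra_simps power2_eq_square power3_eq_cube)
qed

lemma trace_square_linear_pencil:
  fixes A B :: cmat3
  shows "trace ((z *\<^sub>M A + B) ** (z *\<^sub>M A + B)) =
    trace (A ** A) * z\<^sup>2 + 2 * trace (A ** B) * z + trace (B ** B)"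
  by (simp add: trace_def sum_3 matrix_matrix_mult_def algebra_simps power2_eq_square)

lemma det_cscale_3: "det (c *\<^sub>M A) = c ^ 3 * det A"
  by (simp add: det_3 algebra_simps power3_eq_cube)

lemma trace_square_cscale: "trace ((c *\<^sub>M A) ** (c *\<^sub>M A)) = c\<^sup>2 * trace (A ** A)"
  by (simp add: trace_def sum_3 matrix_matrix_mult_def algebra_simps power2_eq_square)

section \<open>Interpolation by a quadratic with values \<open>u\<close>, \<open>v\<close>,
  \<open>w\<close> at 0, 1, -1\<close>

definition quadratic_interpolant :: "complex \<Rightarrow> complex \<Rightarrow> complex \<Rightarrow> complex poly"
  where "quadratic_interpolant u v w = [:u, (v - w) / 2, (v + w) / 2 - u:]"

lemma degree_quadratic_interpolant: "degree (quadratic_interpolant u v w) \<le> 2"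
  by (rule degree_le) (auto simp: quadratic_interpolant_def coeff_pCons split: nat.split)

lemma quadratic_interpolant_eq:
  "poly (quadratic_interpolant c (a + b + c) (a - b + c)) z = a * z\<^sup>2 + b * z + c"
  by (simp add: quadratic_interpolant_def field_simps power2_eq_square)

text \<open>The prescribed values are those of \<open>det\<close> at \<open>-A\<close>,
  \<open>2 B\<close>, \<open>2 C\<close>. Only orbit invariants enter, so a triple and the
  generators of its orbits give the same polynomial.\<close>

definition orbit_Q0 :: "cmat3 \<Rightarrow> cmat3 \<Rightarrow> cmat3 \<Rightarrow> complex poly"
  where "orbit_Q0 A B C = quadratic_interpolant (- det A) (8 * det B) (8 * det C)"

text \<open>The analogue for half the trace of the square, again taken at \<open>-A\<close>,
  \<open>2 B\<close>, \<open>2 C\<close>.\<close>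

definition orbit_Q1 :: "cmat3 \<Rightarrow> cmat3 \<Rightarrow> cmat3 \<Rightarrow> complex poly"
  where "orbit_Q1 A B C = quadratic_interpolant (trace (A ** A) / 2)
    (2 * trace (B ** B)) (2 * trace (C ** C))"

section \<open>The pencil L and its characteristic polynomial\<close>

lemma Lmat_at_poles:
  assumes "X + Y + Z = 0"
  shows "Lmat X Y Z 0 = (- 1) *\<^sub>M X" "Lmat X Y Z 1 = 2 *\<^sub>M Y" "Lmat X Y Z (- 1) = 2 *\<^sub>M Z"
proof -
  have "X = - (Y + Z)"
    using assms by (simp add: eq_neg_iff_add_eq_0 algebra_simps)
  then show "Lmat X Y Z 0 = (- 1) *\<^sub>M X" "Lmat X Y Z 1 = 2 *\<^sub>M Y" "Lmat X Y Z (- 1) = 2 *\<^sub>M Z"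
    by (simp_all add: Lmat_def vec_eq_iff)
qed

text \<open>Clearing denominators gives a quadratic in \<open>z\<close> with leading coefficient
  \<open>X + Y + Z\<close>, which vanishes.\<close>

lemma Lmat_eq_Phi:
  assumes "X + Y + Z = 0" and "z \<notin> {0, 1, -1}"
  shows "(z * (z\<^sup>2 - 1)) *\<^sub>M Phi X Y Z z = Lmat X Y Z z"
proof -
  have X: "X = - (Y + Z)"
    using assms(1) by (simp add: eq_neg_iff_add_eq_0 algebra_simps)
  have nz: "z \<noteq> 0" "z - 1 \<noteq> 0" "z + 1 \<noteq> 0"
    using assms(2) by (auto simp: eq_neg_iff_add_eq_0)
  have "z * (z\<^sup>2 - 1) * (x / z + y / (z - 1) + w / (z + 1))
      = (z\<^sup>2 - 1) * x + z * (z + 1) * y + z * (z - 1) * w" for x y w :: complex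
    using nz by (simp add: divide_simps) (simp add: algebra_simps power2_eq_square)
  then show ?thesis
    unfolding vec_eq_iff
    by (simp add: X Phi_def Lmat_def) (simp add: algebra_simps power2_eq_square)
qed

lemma det_Lmat:
  assumes "X + Y + Z = 0"
  shows "det (Lmat X Y Z z) = det (Y - Z) * (z * (z\<^sup>2 - 1)) + poly (orbit_Q0 X Y Z) z"
proof -
  obtain a b where ab: "det (Lmat X Y Z z) = det (Y - Z) * z ^ 3 + a * z\<^sup>2 + b * z + det (Y + Z)"
    for z
    using det_linear_pencil_3[of "Y - Z" "Y + Z"] unfolding Lmat_def by metis
  define d where "d = det (Y - Z)"
  \<comment> \<open>Since \<open>z ^ 3 = z\<close> at 0, 1, -1, the cubic term acts there as a
    linear one, so \<open>d\<close> joins \<open>b\<close>.\<close>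
  have at_poles: "det (Y + Z) = - det X" "a + (d + b) + det (Y + Z) = 8 * det Y"
    "a - (d + b) + det (Y + Z) = 8 * det Z"
    using ab[of 0] ab[of 1] ab[of "- 1"]
    by (simp_all add: Lmat_at_poles[OF assms] det_cscale_3 d_def algebra_simps)
  have "poly (orbit_Q0 X Y Z) z = a * z\<^sup>2 + (d + b) * z + det (Y + Z)"
    unfolding orbit_Q0_def
    using quadratic_interpolant_eq[of "det (Y + Z)" a "d + b" z] at_poles by metis
  then show ?thesis
    by (simp add: ab d_def algebra_simps power2_eq_square power3_eq_cube)
qed

lemma trace_square_Lmat:
  assumes "X + Y + Z = 0"
  shows "trace (Lmat X Y Z z ** Lmat X Y Z z) / 2 = poly (orbit_Q1 X Y Z) z"
proof -
  define a b c where "a = trace ((Y - Z) ** (Y - Z)) / 2" and "b = trace ((Y - Z) ** (Y + Z))"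
    and "c = trace ((Y + Z) ** (Y + Z)) / 2"
  have abc: "trace (Lmat X Y Z z ** Lmat X Y Z z) / 2 = a * z\<^sup>2 + b * z + c" for z
    unfolding Lmat_def trace_square_linear_pencil by (simp add: a_def b_def c_def field_simps)
  have "c = trace (X ** X) / 2" "a + b + c = 2 * trace (Y ** Y)" "a - b + c = 2 * trace (Z ** Z)"
    using abc[of 0] abc[of 1] abc[of "- 1"]
    by (simp_all add: Lmat_at_poles[OF assms] trace_square_cscale)
  then show ?thesis
    unfolding orbit_Q1_def abc using quadratic_interpolant_eq[of c a b z] by metis
qed

text \<open>The leading coefficient \<open>det (Y - Z)\<close> is written as \<open>\<i> * H\<close>
  to exhibit \<open>H\<close>. Vanishing traces remove the term in \<open>\<eta>\<close>
  squared.\<close>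

lemma rho_zero_sum:
  assumes "X + Y + Z = 0" and "trace Y = 0" and "trace Z = 0"
  shows "rho X Y Z z \<eta> = (\<i> * (- \<i> * det (Y - Z)) * (z * (z\<^sup>2 - 1)) + poly (orbit_Q0 X Y Z) z)
    + poly (orbit_Q1 X Y Z) z * \<eta> - \<eta> ^ 3"
proof -
  have "trace (Lmat X Y Z z) = z * (trace Y - trace Z) + (trace Y + trace Z)"
    by (simp add: Lmat_def trace_def sum_3 algebra_simps)
  then have "trace (Lmat X Y Z z) = 0"
    using assms by simp
  then show ?thesis
    using charpoly_traceless_3[of "Lmat X Y Z z" \<eta>]
    by (simp add: rho_def det_Lmat[OF assms(1)] trace_square_Lmat[OF assms(1)])
qed

section \<open>Uniqueness of the expansion and representatives of a class\<close>

lemma expansion_unique: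
  fixes Q0 Q1 Q0' Q1' :: "complex poly"
  assumes deg: "degree Q0 \<le> 2" "degree Q0' \<le> 2"
    and eq: "\<And>z \<eta>. (\<i> * H * (z * (z\<^sup>2 - 1)) + poly Q0 z) + poly Q1 z * \<eta> - \<eta> ^ 3
      = (\<i> * H' * (z * (z\<^sup>2 - 1)) + poly Q0' z) + poly Q1' z * \<eta> - \<eta> ^ 3"
  shows "H = H'" "Q0 = Q0'" "Q1 = Q1'"
proof -
  have "poly ([:0, - (\<i> * H), 0, \<i> * H:] + Q0) z = poly ([:0, - (\<i> * H'), 0, \<i> * H':] + Q0') z" for z
    using eq[of z 0] by (simp add: algebra_simps power2_eq_square)
  then have p: "[:0, - (\<i> * H), 0, \<i> * H:] + Q0 = [:0, - (\<i> * H'), 0, \<i> * H':] + Q0'"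
    by (simp only: poly_eq_poly_eq_iff[symmetric] fun_eq_iff) blast
  \<comment> \<open>The degree bounds keep \<open>Q0\<close> and \<open>Q0'\<close> out of the cubic
    coefficient, which therefore isolates \<open>H\<close>.\<close>
  have "coeff Q0 3 = 0" "coeff Q0' 3 = 0"
    using deg by (auto intro: coeff_eq_0)
  then show H: "H = H'"
    using arg_cong[OF p, of "\<lambda>q. coeff q 3"] by (simp add: numeral_3_eq_3)
  show Q0: "Q0 = Q0'"
    using p H by simp
  have "poly Q1 z = poly Q1' z" for z
    using eq[of z 1] H Q0 by simp
  then show "Q1 = Q1'"
    by (simp add: poly_eq_poly_eq_iff[symmetric] fun_eq_iff)
qed

text \<open>Simultaneous conjugation of \<open>Y\<close> and \<open>Z\<close> conjugates
  \<open>Y - Z\<close>, so its determinant is a function of the class and a single \<open>H\<close>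
  can serve all representatives.\<close>

lemma triple_reduced_productE:
  assumes "p \<in> triple_reduced_product lam mu nu"
  obtains X Y Z where "(X, Y, Z) \<in> p"
    and "\<forall>(X', Y', Z')\<in>p.
      (X', Y', Z') \<in> zero_sum_triples lam mu nu \<and> det (Y' - Z') = det (Y - Z)"
proof -
  obtain X Y Z where XYZ: "(X, Y, Z) \<in> zero_sum_triples lam mu nu"
    and p: "p = diagonal_conjugacy (zero_sum_triples lam mu nu) `` {(X, Y, Z)}"
    using assms unfolding triple_reduced_product_def quotient_def by auto
  have "(X, Y, Z) \<in> p"
    using XYZ mat_1_in_SU3 by (force simp: p diagonal_conjugacy_def conjugate_mat_1)
  moreover have "(X', Y', Z') \<in> zero_sum_triples lam mu nu \<and> det (Y' - Z') = det (Y - Z)"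
    if "(X', Y', Z') \<in> p" for X' Y' Z'
    using that
    by (auto simp: p diagonal_conjugacy_def det_conjugate SU3_imp_invertible
        simp flip: conjugate_diff)
  ultimately show thesis
    by (intro that) auto
qed

theorem mainTheorem2:
  fixes lam mu nu :: "real^3^3"
  assumes "diagonal_matrix lam" and "trace lam = 0"
    and "diagonal_matrix mu" and "trace mu = 0"
    and "diagonal_matrix nu" and "trace nu = 0"
  shows
    "(\<forall>p\<in>triple_reduced_product lam mu nu. \<forall>(X, Y, Z)\<in>p. \<forall>z. z \<notin> {0, 1, -1} \<longrightarrow>
        (z * (z\<^sup>2 - 1)) *\<^sub>M Phi X Y Z z = Lmat X Y Z z) \<and>
     (\<forall>p\<in>triple_reduced_product lam mu nu. \<exists>!(H, Q0, Q1). rho_expansion p H Q0 Q1) \<and>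
     (\<forall>H Q0 Q1.
        (\<forall>p\<in>triple_reduced_product lam mu nu. rho_expansion p (H p) (Q0 p) (Q1 p)) \<longrightarrow>
          (\<forall>p\<in>triple_reduced_product lam mu nu. \<forall>q\<in>triple_reduced_product lam mu nu.
             Q0 p = Q0 q \<and> Q1 p = Q1 q) \<and>
          (\<forall>p\<in>triple_reduced_product lam mu nu. \<forall>q\<in>triple_reduced_product lam mu nu.
             \<forall>(X, Y, Z)\<in>p. \<forall>(X', Y', Z')\<in>q. \<forall>z \<eta>.
               rho X Y Z z \<eta> - rho X' Y' Z' z \<eta> = \<i> * (H p - H q) * (z * (z\<^sup>2 - 1))) \<and>
          (\<exists>c. \<forall>p\<in>triple_reduced_product lam mu nu. \<forall>(X, Y, Z)\<in>p.
             H p = - \<i> * det (Y - Z) + c \<and>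
             - \<i> * det (Y - Z) = - (\<i> / 3) * trace ((Y - Z) ** (Y - Z) ** (Y - Z))))"
proof -
  let ?P = "triple_reduced_product lam mu nu"
  \<comment> \<open>Built from the orbit generators, \<open>q0\<close> and \<open>q1\<close> involve
    no class \<open>p\<close>.\<close>
  define q0 where "q0 = orbit_Q0 (i_times lam) (i_times mu) (i_times nu)"
  define q1 where "q1 = orbit_Q1 (i_times lam) (i_times mu) (i_times nu)"
  have mem: "X + Y + Z = 0" "trace Y = 0" "trace Z = 0" "orbit_Q0 X Y Z = q0" "orbit_Q1 X Y Z = q1"
    if "(X, Y, Z) \<in> p" "p \<in> ?P" for p X Y Z
  proof -
    have "(X, Y, Z) \<in> zero_sum_triples lam mu nu"
      using that by (blast elim: triple_reduced_productE)
    then show "X + Y + Z = 0" "trace Y = 0" "trace Z = 0" "orbit_Q0 X Y Z = q0" "orbit_Q1 X Y Z = q1"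
      using assms by (auto simp: zero_sum_triples_def q0_def q1_def orbit_Q0_def orbit_Q1_def
          adjoint_orbit_invariants trace_i_times)
  qed
  have rho: "rho X Y Z z \<eta> = (\<i> * (- \<i> * det (Y - Z)) * (z * (z\<^sup>2 - 1)) + poly q0 z)
      + poly q1 z * \<eta> - \<eta> ^ 3"
    if "(X, Y, Z) \<in> p" "p \<in> ?P" for p X Y Z z \<eta>
    using rho_zero_sum[OF mem(1-3)[OF that], of z \<eta>] unfolding mem(4,5)[OF that] .
  have deg: "degree q0 \<le> 2" "degree q1 \<le> 2"
    by (simp_all add: q0_def q1_def orbit_Q0_def orbit_Q1_def degree_quadratic_interpolant)
  \<comment> \<open>Any expansion of a class is the explicit one. This transfers its properties to
    arbitrary families \<open>H\<close>, \<open>Q0\<close>, \<open>Q1\<close>.\<close>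
  have unique: "H = - \<i> * det (Y - Z)" "Q0 = q0" "Q1 = q1"
    if "rho_expansion p H Q0 Q1" "(X, Y, Z) \<in> p" "p \<in> ?P" for p H Q0 Q1 X Y Z
  proof -
    have "degree Q0 \<le> 2"
      and eq: "rho X Y Z z \<eta> = (\<i> * H * (z * (z\<^sup>2 - 1)) + poly Q0 z) + poly Q1 z * \<eta> - \<eta> ^ 3"
      for z \<eta>
      using that(1,2) by (auto simp: rho_expansion_def)
    note * = expansion_unique[OF \<open>degree Q0 \<le> 2\<close> deg(1)
        eq[unfolded rho[OF that(2,3)], symmetric]]
    from * show "H = - \<i> * det (Y - Z)" "Q0 = q0" "Q1 = q1" .
  qed
  have exists: "\<exists>H. rho_expansion p H q0 q1" if p: "p \<in> ?P" for p
  proof -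
    obtain X Y Z where "(X, Y, Z) \<in> p" and "\<forall>(X', Y', Z')\<in>p.
        (X', Y', Z') \<in> zero_sum_triples lam mu nu \<and> det (Y' - Z') = det (Y - Z)"
      by (rule triple_reduced_productE[OF p])
    then have "rho_expansion p (- \<i> * det (Y - Z)) q0 q1"
      using deg rho[OF _ p] by (auto simp: rho_expansion_def)
    then show ?thesis ..
  qed
  have nonempty: "\<exists>X Y Z. (X, Y, Z) \<in> p" if "p \<in> ?P" for p
    using triple_reduced_productE[OF that] by metis

  have expansion_ex1: "\<exists>!(H, Q0, Q1). rho_expansion p H Q0 Q1" if p: "p \<in> ?P" for p
  proof -
    obtain H where H: "rho_expansion p H q0 q1"
      using exists[OF p] by blast
    obtain X Y Z where XYZ: "(X, Y, Z) \<in> p"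
      using nonempty[OF p] by blast
    show ?thesis
    proof (rule ex1I[of _ "(H, q0, q1)"])
      show "case (H, q0, q1) of (H, Q0, Q1) \<Rightarrow> rho_expansion p H Q0 Q1"
        using H by simp
      fix t
      assume "case t of (H, Q0, Q1) \<Rightarrow> rho_expansion p H Q0 Q1"
      then show "t = (H, q0, q1)"
        using unique[OF _ XYZ p] unique(1)[OF H XYZ p] by (cases t) simp
    qed
  qed
  have expansions: "(\<forall>p\<in>?P. \<forall>q\<in>?P. Q0 p = Q0 q \<and> Q1 p = Q1 q) \<and>
      (\<forall>p\<in>?P. \<forall>q\<in>?P. \<forall>(X, Y, Z)\<in>p. \<forall>(X', Y', Z')\<in>q. \<forall>z \<eta>.
         rho X Y Z z \<eta> - rho X' Y' Z' z \<eta> = \<i> * (H p - H q) * (z * (z\<^sup>2 - 1))) \<and>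
      (\<exists>c. \<forall>p\<in>?P. \<forall>(X, Y, Z)\<in>p. H p = - \<i> * det (Y - Z) + c \<and>
         - \<i> * det (Y - Z) = - (\<i> / 3) * trace ((Y - Z) ** (Y - Z) ** (Y - Z)))"
    if exp: "\<forall>p\<in>?P. rho_expansion p (H p) (Q0 p) (Q1 p)" for H Q0 Q1
  proof (intro conjI)
    have Q: "Q0 p = q0" "Q1 p = q1" if "p \<in> ?P" for p
      using nonempty[OF that] unique(2,3)[OF exp[rule_format, OF that] _ that] by blast+
    show "\<forall>p\<in>?P. \<forall>q\<in>?P. Q0 p = Q0 q \<and> Q1 p = Q1 q"
      using Q by simp
    have rho_H: "rho X Y Z z \<eta> = (\<i> * H p * (z * (z\<^sup>2 - 1)) + poly q0 z) + poly q1 z * \<eta> - \<eta> ^ 3"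
      if "(X, Y, Z) \<in> p" "p \<in> ?P" for p X Y Z z \<eta>
      using rho[OF that] unique(1)[OF exp[rule_format, OF that(2)] that] by simp
    show "\<forall>p\<in>?P. \<forall>q\<in>?P. \<forall>(X, Y, Z)\<in>p. \<forall>(X', Y', Z')\<in>q. \<forall>z \<eta>.
        rho X Y Z z \<eta> - rho X' Y' Z' z \<eta> = \<i> * (H p - H q) * (z * (z\<^sup>2 - 1))"
      by (clarsimp simp: rho_H) (simp add: algebra_simps)
    have "- \<i> * det (Y - Z) = - (\<i> / 3) * trace ((Y - Z) ** (Y - Z) ** (Y - Z))"
      if "(X, Y, Z) \<in> p" "p \<in> ?P" for p X Y Z
      using det_traceless_3[of "Y - Z"] mem(2,3)[OF that] by (simp add: trace_sub)
    \<comment> \<open>The expansion fixes \<open>H\<close> exactly, so the additive constant can be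
      taken to be 0.\<close>
    moreover have "H p = - \<i> * det (Y - Z) + 0" if "(X, Y, Z) \<in> p" "p \<in> ?P" for p X Y Z
      using unique(1)[OF exp[rule_format, OF that(2)] that] by simp
    ultimately show "\<exists>c. \<forall>p\<in>?P. \<forall>(X, Y, Z)\<in>p. H p = - \<i> * det (Y - Z) + c \<and>
        - \<i> * det (Y - Z) = - (\<i> / 3) * trace ((Y - Z) ** (Y - Z) ** (Y - Z))"
      by (intro exI[of _ 0]) blast
  qed
  have "\<forall>p\<in>?P. \<forall>(X, Y, Z)\<in>p. \<forall>z. z \<notin> {0, 1, -1} \<longrightarrow>
      (z * (z\<^sup>2 - 1)) *\<^sub>M Phi X Y Z z = Lmat X Y Z z"
    using mem(1) Lmat_eq_Phi by blast
  then show ?thesis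
    by (intro conjI[OF _ conjI] ballI[OF expansion_ex1] allI impI expansions)
qed

end
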